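(* For every digraph $D$, $l(D)\ge f^*(D)$.
   Context: A digraph $D$ is finite with nonempty vertex set $V(D)$, and is identified with a relation $D\subseteq V(D)\times V(D)$ (its set of edges; loops are allowed, no multiple edges). $\overline{D}=(V(D)\times V(D))\setminus D$ is its complement. Trees are finite; a leaf is a vertex of degree 1. Subtrees are nonempty connected subgraphs. A subtree representation of $D$ in a host tree $T$ assigns to each vertex $v$ an ordered pair $(S_v,T_v)$ of subtrees of $T$ (the source subtree and the sink subtree of $v$) such that $uv$ is an edge of $D$ if and only if $S_u$ and $T_v$ have a common vertex (for all $u,v\in V(D)$, including $u=v$). The leafage $l(D)$ is the minimum number of leaves of a host tree in which $D$ has a subtree representation. A digraph is a Ferrers digraph if its successor sets $\{u: vu\in E\}$, over all vertices $v$, are linearly ordered by inclusion; equivalently, its adjacency matrix has no $2\times 2$ permutation submatrix (two rows and two columns, not necessarily consecutive). $f^*(D)$ is the minimum number (possibly $0$, if $\overline{D}=\emptyset$) of pairwise disjoint Ferrers digraphs on $V(D)$ (as edge sets) whose union is $\overline{D}$. *)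

theory Defs
  imports "Graph_Theory.Digraph_Component"
begin

text \<open>
  Digraphs with loops but without multiple edges are pair digraphs. Undirected simple graphs are
  symmetric loop-free pair digraphs (\<^locale>\<open>pair_graph\<close>), so that the degree of a vertex is its
  out-degree. In a symmetric digraph every edge gives a directed cycle of length 2, so the
  library predicate \<^const>\<open>tree\<close> is not the undirected one; undirected cycles correspond to directed
  cycles of length at least 3. Connected digraphs are nonempty by definition.
\<close>

definition undirected_tree :: "'b pair_pre_digraph \<Rightarrow> bool" where
  "undirected_tree T \<longleftrightarrow>
     pair_graph T \<and> connected (with_proj T) \<and>
     \<not> (\<exists>p. pre_digraph.cycle (with_proj T) p \<and> length p \<ge> 3)"

definition leaves :: "'b pair_pre_digraph \<Rightarrow> 'b set" where
  "leaves T = {v \<in> pverts T. out_degree (with_proj T) v = 1}"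

definition subtree :: "'b pair_pre_digraph \<Rightarrow> 'b pair_pre_digraph \<Rightarrow> bool" where
  "subtree H T \<longleftrightarrow>
     pair_graph H \<and> subgraph (with_proj H) (with_proj T) \<and> connected (with_proj H)"

definition subtree_representation ::
  "'a pair_pre_digraph \<Rightarrow> 'b pair_pre_digraph \<Rightarrow>
   ('a \<Rightarrow> 'b pair_pre_digraph \<times> 'b pair_pre_digraph) \<Rightarrow> bool" where
  "subtree_representation D T R \<longleftrightarrow>
     (\<forall>v \<in> pverts D. subtree (fst (R v)) T \<and> subtree (snd (R v)) T) \<and>
     (\<forall>u \<in> pverts D. \<forall>v \<in> pverts D.
        (u, v) \<in> parcs D \<longleftrightarrow> pverts (fst (R u)) \<inter> pverts (snd (R v)) \<noteq> {})"

text \<open>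
  Host trees are finite, so up to isomorphism their vertices are natural numbers. The minimum
  is attained: use a star with enough leaves, a source subtree being the leaf of its vertex, and
  a sink subtree being the center with the leaves of the predecessors.
\<close>

definition leafage :: "'a pair_pre_digraph \<Rightarrow> nat" where
  "leafage D = (LEAST k. \<exists>(T :: nat pair_pre_digraph) R.
     undirected_tree T \<and> subtree_representation D T R \<and> card (leaves T) = k)"

definition digraph_complement :: "'a pair_pre_digraph \<Rightarrow> 'a rel" where
  "digraph_complement D = (pverts D \<times> pverts D) - parcs D"

definition ferrers_on :: "'a set \<Rightarrow> 'a rel \<Rightarrow> bool" where
  "ferrers_on V F \<longleftrightarrow>
     F \<subseteq> V \<times> V \<and> (\<forall>v \<in> V. \<forall>w \<in> V. F `` {v} \<subseteq> F `` {w} \<or> F `` {w} \<subseteq> F `` {v})"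

text \<open>
  The minimum is attained, since a digraph with a single edge is a Ferrers digraph. The
  empty relation may be a member of \<open>\<F>\<close>, which does not affect the minimum.
\<close>

definition ferrers_partition_number :: "'a pair_pre_digraph \<Rightarrow> nat" where
  "ferrers_partition_number D = (LEAST k. \<exists>\<F>.
     finite \<F> \<and> card \<F> = k \<and> (\<forall>F \<in> \<F>. ferrers_on (pverts D) F) \<and>
     pairwise disjnt \<F> \<and> \<Union>\<F> = digraph_complement D)"

end

theory Submission
  imports Defs
begin

text \<open>
  A walk around a plane drawing of a tree with \<open>k \<ge> 1\<close> leaves traverses every arc once and splits
  at the leaves into \<open>k\<close> directed paths. If \<open>uv\<close> is not an edge of the represented digraph, then the
  disjoint subtrees \<open>S\<^sub>u\<close> and \<open>T\<^sub>v\<close> are joined by a path, and we assign \<open>uv\<close> to the directed path that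
  contains its first arc. For two pairs \<open>uv\<close> and \<open>u'v'\<close> assigned to the same directed path, with the
  arc of \<open>uv\<close> coming first, \<open>T\<^bsub>v'\<^esub>\<close> also lies beyond the arc of \<open>uv\<close>, so \<open>uv'\<close> is assigned to that
  directed path as well. Hence the classes are Ferrers digraphs.
\<close>


section \<open>Trees grown by pendant vertices\<close>

text \<open>Gives trees an induction rule, so that arc sides and colours can be built one pendant
  vertex at a time.\<close>

inductive grown_tree :: "'b set \<Rightarrow> 'b rel \<Rightarrow> bool" where
  single: "grown_tree {r} {}"
| pendant: "grown_tree V A \<Longrightarrow> y \<in> V \<Longrightarrow> x \<notin> V \<Longrightarrow>
    grown_tree (insert x V) (insert (x, y) (insert (y, x) A))"

definition endpoints :: "'b rel \<Rightarrow> 'b set" where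
  "endpoints A = {v. \<exists>!w. (v, w) \<in> A}"

lemma grown_tree_arcs_subset: "grown_tree V A \<Longrightarrow> A \<subseteq> V \<times> V"
  by (induction rule: grown_tree.induct) auto

lemma grown_tree_sym: "grown_tree V A \<Longrightarrow> sym A"
  by (induction rule: grown_tree.induct) (auto simp: sym_def)

lemma grown_tree_irrefl: "grown_tree V A \<Longrightarrow> irrefl A"
  by (induction rule: grown_tree.induct) (auto simp: irrefl_def)

lemma grown_tree_finite: "grown_tree V A \<Longrightarrow> finite V \<and> finite A"
  by (induction rule: grown_tree.induct) auto

lemma grown_tree_nonempty: "grown_tree V A \<Longrightarrow> V \<noteq> {}"
  by (induction rule: grown_tree.induct) auto

lemma grown_tree_neighbour:
  "grown_tree V A \<Longrightarrow> v \<in> V \<Longrightarrow> (\<exists>w. (v, w) \<in> A) \<or> V = {v} \<and> A = {}"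
  by (induction rule: grown_tree.induct) auto

section \<open>Arc sides and the chain colouring\<close>

text \<open>
  \<open>B e\<close> is the component at the head of \<open>e\<close> that is left when the edge underlying \<open>e\<close> is removed.
\<close>

locale arc_sides =
  fixes V :: "'b set" and A :: "'b rel" and B :: "'b \<times> 'b \<Rightarrow> 'b set"
  assumes tail_notin: "e \<in> A \<Longrightarrow> fst e \<notin> B e"
    and head_in: "e \<in> A \<Longrightarrow> snd e \<in> B e"
    and side_subset: "e \<in> A \<Longrightarrow> B e \<subseteq> V"
    and enter: "\<lbrakk>e \<in> A; f \<in> A; fst f \<notin> B e; snd f \<in> B e\<rbrakk> \<Longrightarrow> f = e"
    and exit: "\<lbrakk>e \<in> A; f \<in> A; fst f \<in> B e; snd f \<notin> B e\<rbrakk> \<Longrightarrow> snd f = fst e"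
    and divergent: "\<lbrakk>e \<in> A; f \<in> A; e \<noteq> f; fst e \<notin> B f; fst f \<notin> B e\<rbrakk> \<Longrightarrow> B e \<inter> B f = {}"
    and endpoint_side: "\<lbrakk>v \<in> endpoints A; (v, w) \<in> A\<rbrakk> \<Longrightarrow> B (v, w) = V - {v}"

text \<open>
  The colour of an arc stands for the last vertex of the directed path containing it. Sides of arcs
  on a directed path decrease along the path; this is all that is kept of the plane drawing.
\<close>

definition chain_colouring :: "'b rel \<Rightarrow> ('b \<times> 'b \<Rightarrow> 'b set) \<Rightarrow> ('b \<times> 'b \<Rightarrow> 'b) \<Rightarrow> bool" where
  "chain_colouring A B c \<longleftrightarrow>
     (\<forall>e \<in> A. c e \<in> endpoints A \<inter> B e) \<and>
     (\<forall>e \<in> A. \<forall>f \<in> A. c e = c f \<longrightarrow> B e \<subseteq> B f \<or> B f \<subseteq> B e)"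

text \<open>Since \<open>x\<close> hangs at \<open>y\<close>, an old side gains \<open>x\<close>
  exactly if it contains \<open>y\<close>, and the sides of the two new arcs are \<open>{x}\<close>
  and \<open>V\<close>.\<close>

lemma arc_sides_pendant:
  assumes T: "grown_tree V A" and y: "y \<in> V" and x: "x \<notin> V" and B: "arc_sides V A B"
  defines "B' \<equiv> \<lambda>e. if e = (y, x) then {x} else if e = (x, y) then V
                     else if y \<in> B e then insert x (B e) else B e"
  shows "arc_sides (insert x V) (insert (x, y) (insert (y, x) A)) B'"
proof -
  interpret arc_sides V A B by (rule B)
  have AV: "A \<subseteq> V \<times> V" by (rule grown_tree_arcs_subset[OF T])
  have nb: "(\<exists>w. (y, w) \<in> A) \<or> V = {y} \<and> A = {}" by (rule grown_tree_neighbour[OF T y])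
  have xy: "x \<noteq> y" using x y by auto
  have nx: "fst e \<noteq> x" "snd e \<noteq> x" "fst e \<in> V" "snd e \<in> V" "e \<noteq> (y,x)" "e \<noteq> (x,y)" if "e \<in> A" for e
    using that AV x by auto
  have B1: "fst e \<notin> B e" "snd e \<in> B e" "B e \<subseteq> V" "x \<notin> B e" if "e \<in> A" for e
    using tail_notin[OF that] head_in[OF that] side_subset[OF that] x by auto
  have B'1: "B' (y, x) = {x}" "B' (x, y) = V" using xy unfolding B'_def by auto
  have B'2: "B' e = (if y \<in> B e then insert x (B e) else B e)" if "e \<in> A" for e
    using nx[OF that] unfolding B'_def by auto
  let ?A = "insert (x, y) (insert (y, x) A)"
  have 1: "fst e \<notin> B' e" "snd e \<in> B' e" "B' e \<subseteq> insert x V" if "e \<in> ?A" for e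
    using that B1[of e] nx[of e] x y xy by (auto simp: B'1 B'2 split: if_splits)
  have 2: "f = e" if "e \<in> ?A" "f \<in> ?A" "fst f \<notin> B' e" "snd f \<in> B' e" for e f
    using that B1[of e] nx[of e] nx[of f] x y xy enter[of e f]
    by (auto simp: B'1 B'2 split: if_splits)
  have 3: "snd f = fst e" if "e \<in> ?A" "f \<in> ?A" "fst f \<in> B' e" "snd f \<notin> B' e" for e f
    using that B1[of e] nx[of e] nx[of f] x y xy exit[of e f]
    by (auto simp: B'1 B'2 split: if_splits)
  have 4: "B' e \<inter> B' f = {}" if "e \<in> ?A" "f \<in> ?A" "e \<noteq> f" "fst e \<notin> B' f" "fst f \<notin> B' e" for e f
    using that B1[of e] B1[of f] nx[of e] nx[of f] x y xy divergent[of e f]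
    by (auto simp: B'1 B'2 split: if_splits)
  have 5: "B' (v, z) = insert x V - {v}" if v: "v \<in> endpoints ?A" and z: "(v, z) \<in> ?A" for v z
  proof -
    consider "v = x" | "v = y" | "v \<noteq> x" "v \<noteq> y" by blast
    then show ?thesis
    proof cases
      case 1
      then show ?thesis using z AV x xy by (auto simp: B'1)
    next
      case 2
      \<comment> \<open>\<open>y\<close> now has the neighbour \<open>x\<close>, so it can be a leaf
        only if it had no neighbour before.\<close>
      then have "V = {y} \<and> A = {}" using v nb AV x unfolding endpoints_def by auto
      then show ?thesis using z 2 xy by (auto simp: B'1)
    next
      case 3
      then have "(v, z) \<in> A" "v \<in> endpoints A" using v z unfolding endpoints_def by auto
      then show ?thesis using endpoint_side[of v z] 3 y by (auto simp: B'2)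
    qed
  qed
  show ?thesis by (rule arc_sides.intro) (fact 1 2 3 4 5)+
qed

lemma chain_colouring_pendant:
  assumes T: "grown_tree V A" and y: "y \<in> V" and x: "x \<notin> V"
    and B: "arc_sides V A B" and c: "chain_colouring A B c"
  defines "B' \<equiv> \<lambda>e. if e = (y, x) then {x} else if e = (x, y) then V
                     else if y \<in> B e then insert x (B e) else B e"
  shows "\<exists>c'. chain_colouring (insert (x, y) (insert (y, x) A)) B' c'"
proof -
  interpret arc_sides V A B by (rule B)
  let ?A = "insert (x, y) (insert (y, x) A)"
  have AV: "A \<subseteq> V \<times> V" by (rule grown_tree_arcs_subset[OF T])
  have nb: "(\<exists>w. (y, w) \<in> A) \<or> V = {y} \<and> A = {}" by (rule grown_tree_neighbour[OF T y])
  have xy: "x \<noteq> y" using x y by auto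
  have nx: "e \<noteq> (y,x)" "e \<noteq> (x,y)" if "e \<in> A" for e
    using that AV x by auto
  have B1: "fst e \<notin> B e" "snd e \<in> B e" "B e \<subseteq> V" "x \<notin> B e" "fst e \<in> V" if "e \<in> A" for e
    using tail_notin[OF that] head_in[OF that] side_subset[OF that] x that AV by auto
  have c1: "c e \<in> endpoints A" "c e \<in> B e" "c e \<noteq> x" if "e \<in> A" for e
    using that c B1(4)[OF that] unfolding chain_colouring_def by auto
  have c2: "B e \<subseteq> B f \<or> B f \<subseteq> B e" if "e \<in> A" "f \<in> A" "c e = c f" for e f
    using that c unfolding chain_colouring_def by auto
  have B'1: "B' (y, x) = {x}" "B' (x, y) = V" using xy unfolding B'_def by auto
  have B'2: "B' e = (if y \<in> B e then insert x (B e) else B e)" if "e \<in> A" for e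
    using nx[OF that] unfolding B'_def by auto
  have xL: "x \<in> endpoints ?A" using AV x xy unfolding endpoints_def by auto
  have L: "v \<in> endpoints ?A" if "v \<in> endpoints A" "v \<noteq> y" for v
  proof -
    have "v \<noteq> x" using that AV x unfolding endpoints_def by auto
    then show ?thesis using that unfolding endpoints_def by auto
  qed
  \<comment> \<open>The path ending at \<open>i\<close> is cut at \<open>y\<close>: its first part is prolonged to \<open>x\<close>, and its second part now
      starts at \<open>x\<close>. If \<open>y\<close> was a leaf, then \<open>i\<close> is the end of the path starting at \<open>y\<close>, and it is the path
      ending at \<open>y\<close> that is prolonged to \<open>x\<close>.\<close>
  obtain i where i: "i \<in> V" "i \<in> endpoints ?A"
    and iy: "\<And>e. e \<in> A \<Longrightarrow> y \<in> endpoints A \<Longrightarrow> c e = i \<Longrightarrow> y \<notin> B e"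
  proof (cases "A = {}")
    case True
    then have "y \<in> endpoints ?A" using xy unfolding endpoints_def by auto
    then show ?thesis using that y True by auto
  next
    case False
    then obtain w where w: "(y, w) \<in> A" using nb by auto
    let ?i = "c (y, w)"
    show ?thesis
    proof (rule that[of ?i])
      show "?i \<in> V" using c1[OF w] B1[OF w] by auto
      have "?i \<noteq> y" using c1[OF w] B1[OF w] by auto
      then show "?i \<in> endpoints ?A" using c1[OF w] L by auto
      fix e assume e: "e \<in> A" "y \<in> endpoints A" "c e = ?i"
      \<comment> \<open>Were \<open>y\<close> in \<open>B e\<close>, comparability with
        \<open>V - {y}\<close> would make \<open>B e\<close> all of \<open>V\<close>, but the tail
        of \<open>e\<close> is not in \<open>B e\<close>.\<close>
      have "B (y, w) = V - {y}" using endpoint_side e w by auto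
      then show "y \<notin> B e" using c2[OF e(1) w e(3)] B1[OF e(1)] by auto
    qed
  qed
  define r where "r e \<longleftrightarrow> (c e = i \<or> y \<in> endpoints A \<and> c e = y) \<and> y \<in> B e" for e
  define c' where "c' = (\<lambda>e. if e = (y, x) then x else if e = (x, y) then i
                              else if r e then x else c e)"
  have c'1: "c' (y, x) = x" "c' (x, y) = i" using xy unfolding c'_def by auto
  have c'2: "c' e = (if r e then x else c e)" if "e \<in> A" for e
    using nx[OF that] unfolding c'_def by auto
  have ix: "i \<noteq> x" using i x by auto
  \<comment> \<open>An arc of old colour \<open>y\<close> has \<open>y\<close> in its side and is
    recoloured, so a colour that is kept is still a leaf.\<close>
  have 1: "c' e \<in> endpoints ?A \<inter> B' e" if "e \<in> ?A" for e
  proof (cases "e \<in> A")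
    case True
    then show ?thesis using c1[OF True] xL L[of "c e"]
      by (auto simp: c'2 B'2 r_def)
  qed (use that i xL c'1 B'1 in auto)
  \<comment> \<open>If \<open>y\<close> was a leaf, \<open>iy\<close> voids the first alternative in
    \<open>r\<close>; otherwise the second is void. So two recoloured arcs had the same old
    colour.\<close>
  have rr: "B e \<subseteq> B f \<or> B f \<subseteq> B e" if "e \<in> A" "f \<in> A" "r e" "r f" for e f
    using that iy c2 unfolding r_def by metis
  \<comment> \<open>\<open>x\<close> was not a colour, so equal new colours mean that both arcs are
    recoloured or both keep a common old colour.\<close>
  have 2: "B' e \<subseteq> B' f \<or> B' f \<subseteq> B' e" if "e \<in> A" "f \<in> A" "c' e = c' f" for e f
  proof -
    have "B e \<subseteq> B f \<or> B f \<subseteq> B e" 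
      using that c1(3)[of e] c1(3)[of f] rr[of e f] c2[of e f] by (auto simp: c'2 split: if_splits)
    then show ?thesis using that by (auto simp: B'2)
  qed
  \<comment> \<open>Recoloured arcs have \<open>y\<close> in their sides, which therefore gain
    \<open>x\<close>: \<open>(y, x)\<close> is the lower end of their chain.\<close>
  have 3: "B' (y, x) \<subseteq> B' e" if "e \<in> A" "c' e = x" for e
    using that c1(3)[OF that(1)] by (auto simp: c'2 B'2 B'1 r_def split: if_splits)
  \<comment> \<open>An arc that keeps colour \<open>i\<close> does not have \<open>y\<close> in its
    side, so the side stays within \<open>V\<close>: \<open>(x, y)\<close> is the upper end of its
    chain.\<close>
  have 4: "B' e \<subseteq> B' (x, y)" if "e \<in> A" "c' e = i" for e
    using that ix B1(3)[OF that(1)] by (auto simp: c'2 B'2 B'1 r_def split: if_splits)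
  have mixed: "B' e \<subseteq> B' f \<or> B' f \<subseteq> B' e"
    if "e \<in> A" "f = (x, y) \<or> f = (y, x)" "c' e = c' f" for e f
    using that(2) by (elim disjE) (use 3[OF that(1)] 4[OF that(1)] that(3) c'1 in simp_all)
  have new: "e = f"
    if "e = (x, y) \<or> e = (y, x)" "f = (x, y) \<or> f = (y, x)" "c' e = c' f" for e f
    using that(1,2) by (elim disjE) (use that(3) c'1 ix in simp_all)
  have 5: "B' e \<subseteq> B' f \<or> B' f \<subseteq> B' e" if "e \<in> ?A" "f \<in> ?A" "c' e = c' f" for e f
  proof (cases "e \<in> A"; cases "f \<in> A")
    assume "e \<in> A" "f \<in> A"
    then show ?thesis using 2 that(3) by blast
  next
    assume "e \<in> A" "f \<notin> A"
    then show ?thesis using mixed[of e f] that by blast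
  next
    assume "e \<notin> A" "f \<in> A"
    then show ?thesis using mixed[of f e] that by auto
  next
    assume "e \<notin> A" "f \<notin> A"
    then have "e = f" using new[of e f] that by blast
    then show ?thesis by simp
  qed
  have "chain_colouring ?A B' c'"
    unfolding chain_colouring_def using 1 5 by blast
  then show ?thesis by blast
qed

lemma grown_tree_chain_colouring:
  "grown_tree V A \<Longrightarrow> \<exists>B c. arc_sides V A B \<and> chain_colouring A B c"
proof (induction rule: grown_tree.induct)
  case (single r)
  have "arc_sides {r} {} (\<lambda>_. {})" by unfold_locales auto
  then show ?case unfolding chain_colouring_def by auto
next
  case (pendant V A y x)
  then show ?case using arc_sides_pendant chain_colouring_pendant by meson
qed

section \<open>Separating arcs of disjoint connected sets\<close>

text \<open>Strong connectedness of the digraph induced on \<open>X\<close>, phrased through cuts so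
  that taking \<open>P\<close> as a side or its complement yields an arc to which
  \<open>exit\<close> or \<open>enter\<close> applies.\<close>

definition cut_connected :: "'b rel \<Rightarrow> 'b set \<Rightarrow> bool" where
  "cut_connected A X \<longleftrightarrow> X \<noteq> {} \<and>
     (\<forall>P. X \<inter> P \<noteq> {} \<longrightarrow> X - P \<noteq> {} \<longrightarrow> (\<exists>p \<in> X \<inter> P. \<exists>q \<in> X - P. (p, q) \<in> A))"

lemma cut_connectedD:
  assumes "cut_connected A X" "a \<in> X" "a \<in> P" "b \<in> X" "b \<notin> P"
  shows "\<exists>p q. p \<in> X \<and> p \<in> P \<and> q \<in> X \<and> q \<notin> P \<and> (p, q) \<in> A"
  using assms unfolding cut_connected_def by blast

text \<open>For connected \<open>X\<close> and \<open>Y\<close> in a tree, \<open>e\<close> is the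
  arc by which the path from \<open>X\<close> to \<open>Y\<close> leaves \<open>X\<close>.\<close>

definition separates :: "('b \<times> 'b \<Rightarrow> 'b set) \<Rightarrow> 'b set \<Rightarrow> 'b set \<Rightarrow> 'b \<times> 'b \<Rightarrow> bool" where
  "separates B X Y e \<longleftrightarrow> fst e \<in> X \<and> X \<inter> B e = {} \<and> Y \<subseteq> B e"

text \<open>The sides of the arcs leaving \<open>X\<close> fill the tree outside \<open>X\<close>,
  so one of them meets \<open>Y\<close>. \<open>Y\<close> cannot leave this side, because the only
  exit is to the tail of the arc, which lies in \<open>X\<close>.\<close>

lemma (in arc_sides) separating_arc_exists:
  assumes V: "cut_connected A V"
    and X: "cut_connected A X" "X \<subseteq> V" and Y: "cut_connected A Y" "Y \<subseteq> V"
    and XY: "X \<inter> Y = {}"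
  shows "\<exists>e \<in> A. separates B X Y e"
proof -
  \<comment> \<open>To reach \<open>B e\<close>, the connected set \<open>X\<close> would have to
    use \<open>e\<close> itself, but the head of \<open>e\<close> is not in
    \<open>X\<close>.\<close>
  have XB: "X \<inter> B e = {}" if e: "e \<in> A" "fst e \<in> X" "snd e \<notin> X" for e
  proof (rule ccontr)
    assume "X \<inter> B e \<noteq> {}"
    then obtain b where "b \<in> X" "b \<in> B e" by auto
    then obtain p q where "p \<notin> B e" "q \<in> X" "q \<in> B e" "(p, q) \<in> A"
      using cut_connectedD[OF X(1) e(2), of "- B e" b] tail_notin[OF e(1)] head_in[OF e(1)] by blast
    then show False using enter[OF e(1), of "(p, q)"] e(3) by auto
  qed
  obtain x y where x: "x \<in> X" and y: "y \<in> Y"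
    using X(1) Y(1) unfolding cut_connected_def by (meson ex_in_conv)
  \<comment> \<open>No arc leaves \<open>P\<close>, so it is the whole tree.\<close>
  define P where "P = X \<union> \<Union> (B ` {e \<in> A. fst e \<in> X \<and> snd e \<notin> X})"
  have "y \<in> P"
  proof (rule ccontr)
    assume "y \<notin> P"
    moreover have "x \<in> P" using x unfolding P_def by auto
    ultimately obtain p q where pq: "p \<in> P" "q \<notin> P" "(p, q) \<in> A"
      using cut_connectedD[OF V, of x P y] x y X(2) Y(2) by blast
    \<comment> \<open>An arc leaving \<open>X\<close> has its head in its own side, and an arc
      leaving one of the sides ends at a tail in \<open>X\<close>.\<close>
    then show False
      using head_in[OF pq(3)] exit[OF _ pq(3)] unfolding P_def by fastforce
  qed
  then obtain e where e: "e \<in> A" "fst e \<in> X" "snd e \<notin> X" "y \<in> B e"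
    using XY y unfolding P_def by auto
  have "Y \<subseteq> B e"
  proof (rule ccontr)
    assume "\<not> Y \<subseteq> B e"
    then obtain p q where "p \<in> B e" "q \<in> Y" "q \<notin> B e" "(p, q) \<in> A"
      using cut_connectedD[OF Y(1) y e(4)] by (metis subsetI)
    then show False using exit[OF e(1), of "(p, q)"] e(2) XY by auto
  qed
  then show ?thesis using e XB[OF e(1-3)] unfolding separates_def by auto
qed

text \<open>The tails lie in \<open>X\<close>, hence outside both sides. Distinct arcs would thus be
  divergent, with disjoint sides that both contain \<open>Y\<close>.\<close>

lemma (in arc_sides) separating_arc_unique:
  assumes Y: "Y \<noteq> {}"
    and e: "e \<in> A" "separates B X Y e" and f: "f \<in> A" "separates B X Y f"
  shows "e = f"
proof (rule ccontr)
  assume "e \<noteq> f"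
  then have "B e \<inter> B f = {}"
    using divergent[OF e(1) f(1)] e f unfolding separates_def by auto
  then show False using Y e f unfolding separates_def by auto
qed

section \<open>From undirected trees to grown trees\<close>

lemma cut_connected_mono: "cut_connected A X \<Longrightarrow> A \<subseteq> A' \<Longrightarrow> cut_connected A' X"
  unfolding cut_connected_def by blast

text \<open>Symmetry turns connectedness into strong connectedness, and a set that no arc leaves
  contains everything reachable from it.\<close>

lemma connected_imp_cut_connected:
  assumes H: "pair_graph H" and conn: "connected (with_proj H)"
  shows "cut_connected (parcs H) (pverts H)"
proof -
  interpret pair_graph H by (rule H)
  have sc: "strongly_connected (with_proj H)"
    by (rule symmetric_connected_imp_strongly_connected[OF pair_sym_arcs conn])
  have "b \<in> P" if nc: "\<forall>p \<in> pverts H \<inter> P. \<forall>q \<in> pverts H - P. (p, q) \<notin> parcs H"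
    and ab: "a \<in> pverts H" "a \<in> P" "b \<in> pverts H" for P a b
  proof -
    have "reachable (with_proj H) a b" 
      using sc ab unfolding strongly_connected_def by auto
    then have "(a, b) \<in> (parcs H)\<^sup>*" using reachable_rtranclI by fastforce
    then show ?thesis
    proof (induction rule: rtrancl_induct)
      case base
      show ?case by (rule ab(2))
    next
      case (step y z)
      then show ?case using nc in_arcsD1[OF step(2)] in_arcsD2[OF step(2)] by blast
    qed
  qed
  moreover have "pverts H \<noteq> {}" using sc unfolding strongly_connected_def by auto
  ultimately show ?thesis unfolding cut_connected_def by blast
qed

lemma grown_tree_reachable:
  "grown_tree V A \<Longrightarrow> u \<in> V \<Longrightarrow> v \<in> V \<Longrightarrow> (u, v) \<in> A\<^sup>*"
proof (induction arbitrary: u v rule: grown_tree.induct)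
  case (pendant V A y x)
  let ?A = "insert (x, y) (insert (y, x) A)"
  have "(u, y) \<in> ?A\<^sup>*" if "u \<in> insert x V" for u
    using that pendant.IH[of u y] pendant.hyps rtrancl_mono[of A ?A] by blast
  moreover have "(y, v) \<in> ?A\<^sup>*" if "v \<in> insert x V" for v
    using that pendant.IH[of y v] pendant.hyps rtrancl_mono[of A ?A] by blast
  ultimately show ?case using pendant.prems by (meson rtrancl_trans)
qed auto

lemma grown_tree_pair_graph:
  assumes "grown_tree V A"
  shows "pair_graph \<lparr>pverts = V, parcs = A\<rparr>"
proof -
  have "irrefl A" "sym A" "A \<subseteq> V \<times> V" "finite V" "finite A"
    using assms grown_tree_irrefl grown_tree_sym grown_tree_arcs_subset grown_tree_finite by blast+
  then show ?thesis
    by unfold_locales (auto simp: symmetric_def irrefl_def)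
qed

lemma undirected_tree_imp_grown_tree:
  fixes T :: "'b pair_pre_digraph"
  assumes "undirected_tree T"
  shows "grown_tree (pverts T) (parcs T)"
proof -
  have "pair_graph T" and conn: "connected (with_proj T)"
    and acyc: "\<And>p. pre_digraph.cycle (with_proj T) p \<Longrightarrow> length p < 3"
    using assms unfolding undirected_tree_def by (auto simp: not_le)
  then interpret T: pair_graph T by simp
  have cut: "cut_connected (parcs T) (pverts T)"
    by (rule connected_imp_cut_connected[OF T.pair_graph conn])
  \<comment> \<open>A largest grown subtree contains all vertices, and an arc missing from it would close a cycle.\<close>
  define Q where "Q = (\<lambda>(V, A). grown_tree V A \<and> V \<subseteq> pverts T \<and> A \<subseteq> parcs T)"
  obtain r where "r \<in> pverts T" using cut unfolding cut_connected_def by auto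
  then have Qr: "Q ({r}, {})" unfolding Q_def by (auto intro: grown_tree.single)
  have "\<forall>VA. Q VA \<longrightarrow> card (fst VA) < Suc (card (pverts T))"
    unfolding Q_def using card_mono[OF T.pair_finite_verts] by (auto simp: less_Suc_eq_le)
  then obtain VA where VA: "Q VA" "\<And>VA'. Q VA' \<Longrightarrow> card (fst VA') \<le> card (fst VA)"
    using ex_has_greatest_nat[of Q _ "\<lambda>VA. card (fst VA)", OF Qr] by metis
  obtain V A where "VA = (V, A)" by fastforce
  with VA(1) have G: "grown_tree V A" "V \<subseteq> pverts T" "A \<subseteq> parcs T"
    unfolding Q_def by auto
  have max: "card V' \<le> card V" if "Q (V', A')" for V' A'
    using VA(2)[OF that] \<open>VA = (V, A)\<close> by simp
  have sym: "(v, u) \<in> parcs T" if "(u, v) \<in> parcs T" for u v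
    using that T.pair_sym_arcs unfolding symmetric_def by (auto dest: symD)
  have V: "V = pverts T"
  proof (rule ccontr)
    assume "V \<noteq> pverts T"
    moreover obtain a where "a \<in> V" using grown_tree_nonempty[OF G(1)] by auto
    ultimately obtain y x where yx: "y \<in> V" "x \<in> pverts T" "x \<notin> V" "(y, x) \<in> parcs T"
      using cut_connectedD[OF cut, of a V] G(2) by blast
    then have "Q (insert x V, insert (x, y) (insert (y, x) A))"
      unfolding Q_def using G sym by (auto intro: grown_tree.pendant)
    then show False using max yx(3) grown_tree_finite[OF G(1)] by fastforce
  qed
  have "parcs T \<subseteq> A"
  proof
    fix e assume e: "e \<in> parcs T"
    show "e \<in> A"
    proof (rule ccontr)
      assume nA: "e \<notin> A"
      obtain u v where uv: "e = (u, v)" by fastforce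
      have inV: "u \<in> V" "v \<in> V" and ne: "u \<noteq> v"
        using e uv V T.in_arcsD1 T.in_arcsD2 T.pair_no_loops[OF e] by auto
      let ?H = "\<lparr>pverts = V, parcs = A\<rparr>"
      interpret H: pair_graph ?H by (rule grown_tree_pair_graph[OF G(1)])
      have sub: "subgraph (with_proj ?H) (with_proj T)"
        unfolding subgraph_def compatible_def using G H.wf_digraph T.wf_digraph by auto
      have "reachable (with_proj ?H) v u"
        using H.reachable_conv'[of v u] inV grown_tree_reachable[OF G(1), of v u] by simp
      then obtain p where p: "H.apath v p u" using H.reachable_apath by auto
      then have pA: "set p \<subseteq> A" and cas: "pcas v p u"
        unfolding H.apath_def H.awalk_def by auto
      have Tp: "T.apath v p u" by (rule T.subgraph_apath_imp_apath[OF p sub])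
      have "T.cycle (e # p)"
        unfolding T.cycle_def using Tp e uv
        by (intro exI[of _ u]) (auto simp: T.apath_def T.awalk_Cons_iff)
      \<comment> \<open>Cycles of length 2 are not excluded, so \<open>p\<close> may be a single
        arc. This is the reverse of \<open>e\<close>, and \<open>A\<close> is symmetric.\<close>
      then have "length p < 2" using acyc[of "e # p"] by simp
      moreover have "p \<noteq> []" using cas ne by auto
      ultimately obtain f where "p = [f]" by (cases p) auto
      then have "(v, u) \<in> A" using pA cas by (cases f) auto
      then show False using nA uv grown_tree_sym[OF G(1)] by (auto dest: symD)
    qed
  qed
  then show ?thesis using G V by auto
qed

lemma leaves_eq_endpoints:
  assumes "pair_wf_digraph T"
  shows "leaves T = endpoints (parcs T)"
proof -
  interpret pair_wf_digraph T by (rule assms)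
  have "out_degree (with_proj T) v = card {w. (v, w) \<in> parcs T}" for v
  proof -
    have "out_arcs (with_proj T) v = Pair v ` {w. (v, w) \<in> parcs T}"
      unfolding out_arcs_def by auto
    then show ?thesis unfolding out_degree_def by (simp add: card_image inj_on_def)
  qed
  then show ?thesis
    unfolding leaves_def endpoints_def
    by (auto simp: card_1_singleton_iff in_arcsD1 set_eq_iff)
qed

section \<open>Ferrers classes from a subtree representation\<close>

text \<open>Each leaf gets the pairs whose separating arc has its colour. A host tree with a single
  vertex is covered: disjoint subtrees do not exist there, so the complement is empty.\<close>

lemma ferrers_partition_number_le:
  fixes D :: "'a pair_pre_digraph" and T :: "'b pair_pre_digraph"
  assumes T: "undirected_tree T" and R: "subtree_representation D T R"
  shows "ferrers_partition_number D \<le> card (leaves T)"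
proof -
  let ?V = "pverts T" and ?A = "parcs T"
  have pg: "pair_graph T" and conn: "connected (with_proj T)"
    using T unfolding undirected_tree_def by auto
  interpret T: pair_graph T by (rule pg)
  obtain B c where B: "arc_sides ?V ?A B" and c: "chain_colouring ?A B c"
    using grown_tree_chain_colouring[OF undirected_tree_imp_grown_tree[OF T]] by blast
  interpret arc_sides ?V ?A B by (rule B)
  define S where "S v = pverts (fst (R v))" for v
  define U where "U v = pverts (snd (R v))" for v
  have sub: "cut_connected ?A (pverts H) \<and> pverts H \<subseteq> ?V" if "subtree H T" for H
    using that connected_imp_cut_connected[of H] cut_connected_mono[of "parcs H" _ ?A]
    unfolding subtree_def subgraph_def by auto
  have S: "cut_connected ?A (S v)" "S v \<subseteq> ?V" and U: "cut_connected ?A (U v)" "U v \<subseteq> ?V"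
    if "v \<in> pverts D" for v
    using that R sub unfolding subtree_representation_def S_def U_def by auto
  have U_ne: "U v \<noteq> {}" if "v \<in> pverts D" for v
    using U(1)[OF that] unfolding cut_connected_def by auto
  have D: "(u, v) \<in> parcs D \<longleftrightarrow> S u \<inter> U v \<noteq> {}" if "u \<in> pverts D" "v \<in> pverts D" for u v
    using that R unfolding subtree_representation_def S_def U_def by auto
  have V: "cut_connected ?A ?V" by (rule connected_imp_cut_connected[OF pg conn])
  define F where "F l = {(u, v). u \<in> pverts D \<and> v \<in> pverts D \<and>
    (\<exists>e \<in> ?A. c e = l \<and> separates B (S u) (U v) e)}" for l
  have ferrers: "ferrers_on (pverts D) (F l)" for l
    unfolding ferrers_on_def
  proof (intro conjI ballI)
    show "F l \<subseteq> pverts D \<times> pverts D" unfolding F_def by auto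
    fix v w assume "v \<in> pverts D" "w \<in> pverts D"
    show "F l `` {v} \<subseteq> F l `` {w} \<or> F l `` {w} \<subseteq> F l `` {v}"
    proof (rule ccontr)
      assume "\<not> ?thesis"
      then obtain x y where x: "(v, x) \<in> F l" "(w, x) \<notin> F l" and y: "(w, y) \<in> F l" "(v, y) \<notin> F l"
        by blast
      obtain e where e: "e \<in> ?A" "c e = l" "separates B (S v) (U x) e"
        using x(1) unfolding F_def by auto
      obtain f where f: "f \<in> ?A" "c f = l" "separates B (S w) (U y) f"
        using y(1) unfolding F_def by auto
      have "B e \<subseteq> B f \<or> B f \<subseteq> B e"
        using c e f unfolding chain_colouring_def by metis
      \<comment> \<open>The larger side contains both sink subtrees, so its arc also separates its
        source subtree from the other sink subtree.\<close>
      then have "separates B (S w) (U x) f \<or> separates B (S v) (U y) e"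
        using e(3) f(3) unfolding separates_def by blast
      then show False using x y e f unfolding F_def by blast
    qed
  qed
  have disj: "disjnt (F k) (F l)" if "k \<noteq> l" for k l
    unfolding disjnt_iff
  proof (intro allI notI, elim conjE)
    fix a assume "a \<in> F k" "a \<in> F l"
    then obtain u v e f where "v \<in> pverts D" "e \<in> ?A" "c e = k" "separates B (S u) (U v) e"
      "f \<in> ?A" "c f = l" "separates B (S u) (U v) f"
      unfolding F_def by blast
    then show False using separating_arc_unique[OF U_ne, of v e "S u" f] that by auto
  qed
  have cover: "\<Union> (F ` leaves T) = digraph_complement D"
  proof (intro equalityI subsetI)
    fix a assume "a \<in> \<Union> (F ` leaves T)"
    then obtain u v e where "a = (u, v)" "u \<in> pverts D" "v \<in> pverts D"
      "separates B (S u) (U v) e"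
      unfolding F_def by blast
    then show "a \<in> digraph_complement D"
      using D[of u v] unfolding separates_def digraph_complement_def by auto
  next
    fix a assume "a \<in> digraph_complement D"
    then obtain u v where a: "a = (u, v)" "u \<in> pverts D" "v \<in> pverts D" "S u \<inter> U v = {}"
      using D unfolding digraph_complement_def by blast
    obtain e where e: "e \<in> ?A" "separates B (S u) (U v) e"
      using separating_arc_exists[OF V S[OF a(2)] U[OF a(3)] a(4)] by auto
    have "c e \<in> leaves T"
      using c e(1) leaves_eq_endpoints[OF T.pair_wf_digraph] unfolding chain_colouring_def by auto
    moreover have "a \<in> F (c e)" using a e unfolding F_def by auto
    ultimately show "a \<in> \<Union> (F ` leaves T)" by auto
  qed
  have fin: "finite (leaves T)" using T.pair_finite_verts unfolding leaves_def by auto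
  have "ferrers_partition_number D \<le> card (F ` leaves T)"
    unfolding ferrers_partition_number_def
  proof (rule Least_le, intro exI[of _ "F ` leaves T"] conjI ballI)
    show "pairwise disjnt (F ` leaves T)"
      unfolding pairwise_image by (auto intro!: pairwiseI disj)
  qed (use fin ferrers cover in auto)
  \<comment> \<open>Empty classes of different leaves coincide, so there may be fewer classes than
    leaves.\<close>
  also have "\<dots> \<le> card (leaves T)" by (rule card_image_le[OF fin])
  finally show ?thesis .
qed

section \<open>Existence of a representation in a star\<close>

definition star :: "nat set \<Rightarrow> nat pair_pre_digraph" where
  "star M = \<lparr>pverts = insert 0 M, parcs = {0} \<times> M \<union> M \<times> {0}\<rparr>"

lemma star_simps: "pverts (star M) = insert 0 M" "parcs (star M) = {0} \<times> M \<union> M \<times> {0}"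
  unfolding star_def by auto

lemma pair_graph_star:
  assumes "finite M" "0 \<notin> M"
  shows "pair_graph (star M)"
proof
  have "sym (parcs (star M))" by (rule symI) (auto simp: star_simps)
  then show "symmetric (with_proj (star M))" unfolding symmetric_def by simp
  show "finite (pverts (star M))" "finite (parcs (star M))" using assms by (simp_all add: star_simps)
  fix e assume "e \<in> parcs (star M)"
  then show "fst e \<in> pverts (star M)" "snd e \<in> pverts (star M)" "fst e \<noteq> snd e"
    using assms by (auto simp: star_simps)
qed

lemma connected_star:
  assumes "finite M" "0 \<notin> M"
  shows "connected (with_proj (star M))"
proof -
  interpret pair_graph "star M" by (rule pair_graph_star[OF assms])
  show ?thesis
  proof (rule connectedI)
    fix u v assume uv: "u \<in> pverts (star M)" "v \<in> pverts (star M)"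
    have "reachable (with_proj (star M)) u 0" if "u \<noteq> 0"
      using uv that by (intro reachable_adjI) (simp add: star_simps)
    moreover have "reachable (with_proj (star M)) 0 v" if "v \<noteq> 0"
      using uv that by (intro reachable_adjI) (simp add: star_simps)
    moreover have "reachable (with_proj (star M)) 0 0"
      by (intro reachable_refl) (simp add: star_simps)
    ultimately have "reachable (with_proj (star M)) u 0" "reachable (with_proj (star M)) 0 v"
      by metis+
    then have "reachable (with_proj (star M)) u v" by (rule reachable_trans)
    then show "reachable (mk_symmetric (star M)) u v" by (rule reachable_mk_symmetricI)
  qed (simp add: star_simps)
qed

text \<open>Every second vertex of a walk is \<open>0\<close>. A closed walk with at least three
  arcs therefore meets \<open>0\<close> twice after its start, which a cycle does not.\<close>

lemma undirected_tree_star: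
  assumes "finite M" "0 \<notin> M"
  shows "undirected_tree (star M)"
proof -
  interpret pair_graph "star M" by (rule pair_graph_star[OF assms])
  have "length p < 3" if cyc: "cycle p" for p
  proof (rule ccontr)
    assume "\<not> length p < 3"
    then obtain e1 e2 e3 q where p: "p = e1 # e2 # e3 # q"
      by (auto simp: not_less numeral_3_eq_3 Suc_le_length_iff)
    obtain u where u: "set p \<subseteq> parcs (star M)" "pcas u p u" "distinct (tl (pawalk_verts u p))"
      using cyc unfolding cycle_def awalk_def by auto
    have "w \<in> set (pawalk_verts v es)" if "pcas v es w" for v w :: nat and es
      using that by (induction es arbitrary: v) auto
    moreover have q: "pcas (snd e3) q u" using u(2) p by auto
    ultimately have "u \<in> set (pawalk_verts (snd e3) q)" by blast
    moreover have "snd e3 \<in> set (pawalk_verts (snd e3) q)" using q by (cases q) auto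
    ultimately
    show False using u p by (auto simp: star_simps)
  qed
  then show ?thesis
    unfolding undirected_tree_def using pair_graph connected_star[OF assms] by force
qed

lemma subtree_star:
  assumes "finite N" "0 \<notin> N" "M \<subseteq> N"
  shows "subtree (star M) (star N)"
proof -
  have M: "finite M" "0 \<notin> M" using assms finite_subset by auto
  interpret M: pair_graph "star M" by (rule pair_graph_star[OF M])
  interpret N: pair_graph "star N" by (rule pair_graph_star[OF assms(1,2)])
  show ?thesis
    unfolding subtree_def subgraph_def compatible_def
    using M.pair_graph connected_star[OF M] M.wf_digraph N.wf_digraph assms(3)
    by (auto simp: star_simps)
qed

lemma subtree_singleton:
  assumes "pair_graph T" "v \<in> pverts T"
  shows "subtree \<lparr>pverts = {v}, parcs = {}\<rparr> T"
proof -
  let ?H = "\<lparr>pverts = {v}, parcs = {}\<rparr>"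
  interpret T: pair_graph T by (rule assms)
  interpret H: pair_graph ?H
    using grown_tree_pair_graph[OF grown_tree.single[of v]] .
  have "connected (with_proj ?H)"
    by (rule H.connectedI) (auto intro!: H.reachable_mk_symmetricI H.reachable_refl)
  then show ?thesis
    unfolding subtree_def subgraph_def compatible_def
    using H.pair_graph H.wf_digraph T.wf_digraph assms(2) by auto
qed

text \<open>Ensures that the minimum in \<open>leafage\<close> is attained. All sink stars contain
  the centre, but the source subtrees avoid it.\<close>

lemma subtree_representation_exists:
  assumes "finite (pverts D)"
  shows "\<exists>(T :: nat pair_pre_digraph) R. undirected_tree T \<and> subtree_representation D T R"
proof -
  obtain g :: "'a \<Rightarrow> nat" where g: "inj_on g (pverts D)"
    using finite_imp_inj_to_nat_seg[OF assms] by auto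
  \<comment> \<open>\<open>Suc\<close> keeps \<open>0\<close> free for the centre.\<close>
  define h where "h v = Suc (g v)" for v
  have h: "h u = h v \<longleftrightarrow> u = v" if "u \<in> pverts D" "v \<in> pverts D" for u v
    using that g unfolding h_def inj_on_def by auto
  define M where "M = h ` pverts D"
  define P where "P v = h ` {u \<in> pverts D. (u, v) \<in> parcs D}" for v
  define R where "R v = (\<lparr>pverts = {h v}, parcs = {}\<rparr>, star (P v))" for v
  have M: "finite M" "0 \<notin> M" using assms unfolding M_def h_def by auto
  have "subtree (fst (R v)) (star M) \<and> subtree (snd (R v)) (star M)" if "v \<in> pverts D" for v
    using subtree_singleton[OF pair_graph_star[OF M], of "h v"] subtree_star[OF M, of "P v"] that
    unfolding R_def P_def M_def by (auto simp: star_simps)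
  moreover have "(u, v) \<in> parcs D \<longleftrightarrow> pverts (fst (R u)) \<inter> pverts (snd (R v)) \<noteq> {}"
    if "u \<in> pverts D" "v \<in> pverts D" for u v
  proof -
    have "h u \<noteq> 0" unfolding h_def by simp
    then show ?thesis
      using that h unfolding R_def P_def by (auto simp: star_simps)
  qed
  ultimately have "subtree_representation D (star M) R"
    unfolding subtree_representation_def by blast
  then show ?thesis using undirected_tree_star[OF M] by blast
qed

theorem theorem3:
  fixes D :: "'a pair_pre_digraph"
  assumes "pair_fin_digraph D"
    and "pverts D \<noteq> {}"
  shows "leafage D \<ge> ferrers_partition_number D"
proof -
  let ?P = "\<lambda>k. \<exists>(T :: nat pair_pre_digraph) R.
    undirected_tree T \<and> subtree_representation D T R \<and> card (leaves T) = k"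
  have "finite (pverts D)" using assms(1) by (rule pair_fin_digraph.pair_finite_verts)
  then have "\<exists>k. ?P k" using subtree_representation_exists by blast
  then have "?P (leafage D)" unfolding leafage_def by (rule LeastI_ex)
  then show ?thesis using ferrers_partition_number_le by metis
qed

end
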